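(* Let $E$ be a complex Banach space and $B_E$ its open unit ball. Then every $f\in H^\infty(B_E)$ satisfies $\|f\|_{inv}<\infty$, i.e. $H^\infty(B_E)\subset\mathcal{B}_{inv}(B_E)$, and the canonical map $Id:(H^\infty(B_E),\|\cdot\|_\infty)\to(\mathcal{B}_{inv}(B_E),\|\cdot\|_{inv-Bloch})$ is continuous.
   Context: $H(B_E)$ is the space of holomorphic (complex Fréchet differentiable) functions $f:B_E\to\mathbb{C}$; $H^\infty(B_E)$ is the space of bounded functions in $H(B_E)$ with $\|f\|_\infty=\sup_{x\in B_E}|f(x)|$; $Aut(B_E)$ is the set of all biholomorphic bijections $\phi:B_E\to B_E$. For $f\in H(B_E)$ put $\|f\|_{inv}=\sup_{\phi\in Aut(B_E)}\|(f\circ\phi)'(0)\|$ (dual norm of $E^*$). $\mathcal{B}_{inv}(B_E)$ is the space of $f\in H(B_E)$ with $\|f\|_{inv}<\infty$, where functions $f,g$ with $\|f-g\|_{inv}=0$ are identified when it is regarded as a normed space; its norm is $\|f\|_{inv-Bloch}=\|f\|_{inv}$. The map $Id$ sends $f$ to (the class of) $f$. *)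

theory Defs
  imports "HOL-Analysis.Analysis"
begin

section \<open>Complex Banach spaces\<close>

class complex_normed_vector = real_normed_vector +
  fixes scaleC :: "complex \<Rightarrow> 'a \<Rightarrow> 'a"  (infixr "*\<^sub>C" 75)
  assumes scaleC_add_right: "a *\<^sub>C (x + y) = a *\<^sub>C x + a *\<^sub>C y"
    and scaleC_add_left: "(a + b) *\<^sub>C x = a *\<^sub>C x + b *\<^sub>C x"
    and scaleC_scaleC: "a *\<^sub>C b *\<^sub>C x = (a * b) *\<^sub>C x"
    and scaleC_one: "1 *\<^sub>C x = x"
    and scaleR_scaleC: "r *\<^sub>R x = complex_of_real r *\<^sub>C x"
    and norm_scaleC: "norm (a *\<^sub>C x) = cmod a * norm x"

class complex_banach = complex_normed_vector + banach

instantiation complex :: complex_banach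
begin

definition scaleC_complex :: "complex \<Rightarrow> complex \<Rightarrow> complex"
  where "scaleC_complex a x = a * x"

instance
  by standard (auto simp: scaleC_complex_def algebra_simps norm_mult scaleR_conv_of_real)

end


section \<open>Holomorphic functions and automorphisms of the unit ball\<close>

text \<open>The sets below are open, so the derivative is the unrestricted one; \<open>has_derivative\<close>
  already makes it a bounded real-linear map.\<close>

definition cfrechet_holomorphic_on ::
    "('a::complex_normed_vector \<Rightarrow> 'b::complex_normed_vector) \<Rightarrow> 'a set \<Rightarrow> bool"
  where "cfrechet_holomorphic_on f U \<longleftrightarrow>
    (\<forall>x\<in>U. \<exists>D. (f has_derivative D) (at x) \<and> (\<forall>c v. D (c *\<^sub>C v) = c *\<^sub>C D v))"

text \<open>A function on the ball is represented by its extension by zero, so that equality of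
  representatives is equality on the ball and pointwise differences are again
  representatives.\<close>

definition H_ball :: "('a::complex_banach \<Rightarrow> complex) set"
  where "H_ball = {f. cfrechet_holomorphic_on f (ball 0 1) \<and> (\<forall>x. x \<notin> ball 0 1 \<longrightarrow> f x = 0)}"

definition H_infty :: "('a::complex_banach \<Rightarrow> complex) set"
  where "H_infty = {f \<in> H_ball. bounded (f ` ball 0 1)}"

definition sup_norm :: "('a::complex_banach \<Rightarrow> complex) \<Rightarrow> real"
  where "sup_norm f = (SUP x\<in>ball 0 1. cmod (f x))"

text \<open>The locale \<open>Metric_space\<close> asks for nonnegativity and symmetry also off the carrier, hence the
  default value \<open>0\<close> here and in \<open>bloch_dist\<close>.\<close>

definition sup_dist :: "('a::complex_banach \<Rightarrow> complex) \<Rightarrow> ('a \<Rightarrow> complex) \<Rightarrow> real"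
  where "sup_dist f g = (if f \<in> H_infty \<and> g \<in> H_infty then sup_norm (\<lambda>x. f x - g x) else 0)"

text \<open>The values of an automorphism outside the ball are unconstrained; they do not affect the
  derivative at \<open>0\<close> of a composition \<open>f \<circ> \<phi>\<close>.\<close>

definition Aut_ball :: "('a::complex_banach \<Rightarrow> 'a) set"
  where "Aut_ball = {\<phi>. bij_betw \<phi> (ball 0 1) (ball 0 1) \<and>
    cfrechet_holomorphic_on \<phi> (ball 0 1) \<and>
    cfrechet_holomorphic_on (inv_into (ball 0 1) \<phi>) (ball 0 1)}"


section \<open>The invariant Bloch space\<close>

definition inv_seminorm :: "('a::complex_banach \<Rightarrow> complex) \<Rightarrow> ennreal"
  where "inv_seminorm f =
    (SUP \<phi>\<in>Aut_ball. ennreal (onorm (frechet_derivative (f \<circ> \<phi>) (at 0))))"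

definition B_inv :: "('a::complex_banach \<Rightarrow> complex) set"
  where "B_inv = {f \<in> H_ball. inv_seminorm f < \<infinity>}"

definition bloch_rel :: "(('a::complex_banach \<Rightarrow> complex) \<times> ('a \<Rightarrow> complex)) set"
  where "bloch_rel = {(f, g). f \<in> B_inv \<and> g \<in> B_inv \<and> inv_seminorm (\<lambda>x. f x - g x) = 0}"

definition bloch_space :: "('a::complex_banach \<Rightarrow> complex) set set"
  where "bloch_space = B_inv // bloch_rel"

definition bloch_class :: "('a::complex_banach \<Rightarrow> complex) \<Rightarrow> ('a \<Rightarrow> complex) set"
  where "bloch_class f = bloch_rel `` {f}"

text \<open>Difference and norm of equivalence classes, computed on arbitrary representatives; the
  theorems \<open>bloch_diff_class\<close> and \<open>bloch_norm_class\<close> state independence of the choice.\<close>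

definition bloch_diff ::
    "('a::complex_banach \<Rightarrow> complex) set \<Rightarrow> ('a \<Rightarrow> complex) set \<Rightarrow> ('a \<Rightarrow> complex) set"
  where "bloch_diff X Y = (\<Union>f\<in>X. \<Union>g\<in>Y. bloch_class (\<lambda>x. f x - g x))"

definition bloch_norm :: "('a::complex_banach \<Rightarrow> complex) set \<Rightarrow> real"
  where "bloch_norm X = the_elem ((\<lambda>f. enn2real (inv_seminorm f)) ` X)"

definition bloch_dist ::
    "('a::complex_banach \<Rightarrow> complex) set \<Rightarrow> ('a \<Rightarrow> complex) set \<Rightarrow> real"
  where "bloch_dist X Y =
    (if X \<in> bloch_space \<and> Y \<in> bloch_space then bloch_norm (bloch_diff X Y) else 0)"


section \<open>The two spaces are metric spaces\<close>

lemma cfrechet_holomorphic_on_diff: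
  fixes f g :: "'a::complex_normed_vector \<Rightarrow> complex"
  assumes "cfrechet_holomorphic_on f U" "cfrechet_holomorphic_on g U"
  shows "cfrechet_holomorphic_on (\<lambda>x. f x - g x) U"
  unfolding cfrechet_holomorphic_on_def
proof
  fix x assume "x \<in> U"
  then obtain D E where "(f has_derivative D) (at x)" "\<forall>c v. D (c *\<^sub>C v) = c *\<^sub>C D v"
    "(g has_derivative E) (at x)" "\<forall>c v. E (c *\<^sub>C v) = c *\<^sub>C E v"
    using assms unfolding cfrechet_holomorphic_on_def by meson
  then show "\<exists>D. ((\<lambda>x. f x - g x) has_derivative D) (at x) \<and> (\<forall>c v. D (c *\<^sub>C v) = c *\<^sub>C D v)"
    by (intro exI[of _ "\<lambda>v. D v - E v"])
      (auto intro!: has_derivative_diff simp: scaleC_complex_def algebra_simps)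
qed

lemma H_ball_diff: "f \<in> H_ball \<Longrightarrow> g \<in> H_ball \<Longrightarrow> (\<lambda>x. f x - g x) \<in> H_ball"
  by (simp add: H_ball_def cfrechet_holomorphic_on_diff)

lemma H_ball_0: "(\<lambda>x. 0) \<in> H_ball"
proof -
  have "\<exists>D. ((\<lambda>x::'a. 0::complex) has_derivative D) (at x) \<and>
      (\<forall>c v. D (c *\<^sub>C v) = c *\<^sub>C D v)" for x
    by (rule exI[of _ "\<lambda>v. 0"]) (simp add: scaleC_complex_def)
  then show ?thesis
    by (simp add: H_ball_def cfrechet_holomorphic_on_def)
qed

lemma H_ball_comp_differentiable:
  assumes f: "f \<in> H_ball" and p: "p \<in> Aut_ball"
  shows "(f \<circ> p) differentiable (at 0)"
proof -
  have p0: "p 0 \<in> ball 0 1"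
    using p by (auto simp: Aut_ball_def dest!: bij_betwE)
  obtain D where D: "(p has_derivative D) (at 0)"
    using p unfolding Aut_ball_def cfrechet_holomorphic_on_def by force
  obtain E where E: "(f has_derivative E) (at (p 0))"
    using f p0 unfolding H_ball_def cfrechet_holomorphic_on_def by blast
  show ?thesis
    using diff_chain_at[OF D E] unfolding differentiable_def by blast
qed

lemma inv_seminorm_diff_le:
  assumes f: "f \<in> H_ball" and g: "g \<in> H_ball"
  shows "inv_seminorm (\<lambda>x. f x - g x) \<le> inv_seminorm f + inv_seminorm g"
  unfolding inv_seminorm_def
proof (rule SUP_least)
  fix p :: "'a \<Rightarrow> 'a" assume p: "p \<in> Aut_ball"
  let ?D = "frechet_derivative (f \<circ> p) (at 0)" and ?E = "frechet_derivative (g \<circ> p) (at 0)"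
  have D: "((f \<circ> p) has_derivative ?D) (at 0)" and E: "((g \<circ> p) has_derivative ?E) (at 0)"
    using H_ball_comp_differentiable[OF f p] H_ball_comp_differentiable[OF g p]
    by (simp_all add: frechet_derivative_works)
  have bl: "bounded_linear ?D" "bounded_linear ?E"
    using D E by (auto intro: has_derivative_bounded_linear)
  have "(((\<lambda>x. f x - g x) \<circ> p) has_derivative (\<lambda>v. ?D v - ?E v)) (at 0)"
    using has_derivative_diff[OF D E] by (simp add: o_def)
  then have "frechet_derivative ((\<lambda>x. f x - g x) \<circ> p) (at 0) = (\<lambda>v. ?D v - ?E v)"
    by (metis frechet_derivative_at)
  moreover have "onorm (\<lambda>v. ?D v - ?E v) \<le> onorm ?D + onorm ?E"
    using onorm_triangle[OF bl(1) bounded_linear_minus[OF bl(2)]]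
    by (simp add: onorm_neg)
  ultimately have "ennreal (onorm (frechet_derivative ((\<lambda>x. f x - g x) \<circ> p) (at 0)))
      \<le> ennreal (onorm ?D) + ennreal (onorm ?E)"
    using bl by (simp add: onorm_pos_le flip: ennreal_plus)
  also have "\<dots> \<le> (SUP p\<in>Aut_ball. ennreal (onorm (frechet_derivative (f \<circ> p) (at 0))))
      + (SUP p\<in>Aut_ball. ennreal (onorm (frechet_derivative (g \<circ> p) (at 0))))"
    by (intro add_mono SUP_upper p)
  finally show "ennreal (onorm (frechet_derivative ((\<lambda>x. f x - g x) \<circ> p) (at 0))) \<le> \<dots>" .
qed

lemma inv_seminorm_0: "inv_seminorm (\<lambda>x. 0) = 0"
proof -
  have "frechet_derivative ((\<lambda>x. 0) \<circ> p) (at 0) = (\<lambda>v. 0 :: complex)" for p :: "'a \<Rightarrow> 'a"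
    by (simp add: o_def)
  then have "inv_seminorm (\<lambda>x :: 'a. 0) \<le> 0"
    unfolding inv_seminorm_def by (intro SUP_least) (simp add: onorm_zero)
  then show ?thesis
    by simp
qed

lemma B_inv_diff: "f \<in> B_inv \<Longrightarrow> g \<in> B_inv \<Longrightarrow> (\<lambda>x. f x - g x) \<in> B_inv"
  using le_less_trans[OF inv_seminorm_diff_le[of f g], of \<infinity>]
  by (simp add: B_inv_def H_ball_diff)

lemma inv_seminorm_minus_le:
  assumes "f \<in> H_ball" "g \<in> H_ball"
  shows "inv_seminorm (\<lambda>x. g x - f x) \<le> inv_seminorm (\<lambda>x. f x - g x)"
  using inv_seminorm_diff_le[OF H_ball_0 H_ball_diff[OF assms]]
  by (simp add: inv_seminorm_0)

lemma inv_seminorm_minus: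
  "f \<in> H_ball \<Longrightarrow> g \<in> H_ball \<Longrightarrow> inv_seminorm (\<lambda>x. g x - f x) = inv_seminorm (\<lambda>x. f x - g x)"
  by (intro antisym inv_seminorm_minus_le)

lemma inv_seminorm_triangle:
  assumes "f \<in> H_ball" "g \<in> H_ball" "h \<in> H_ball"
  shows "inv_seminorm (\<lambda>x. f x - h x) \<le> inv_seminorm (\<lambda>x. f x - g x) + inv_seminorm (\<lambda>x. g x - h x)"
  using inv_seminorm_diff_le[of "\<lambda>x. f x - g x" "\<lambda>x. h x - g x"] assms
  by (simp add: H_ball_diff inv_seminorm_minus[of g h])

lemma B_inv_H_ball: "f \<in> B_inv \<Longrightarrow> f \<in> H_ball"
  by (simp add: B_inv_def)

lemma B_inv_0: "(\<lambda>x. 0) \<in> B_inv"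
  by (simp add: B_inv_def H_ball_0 inv_seminorm_0)

lemma equiv_bloch_rel: "equiv B_inv bloch_rel"  (is "equiv ?B ?R")
proof (rule equivI)
  show "?R \<subseteq> ?B \<times> ?B"
    by (auto simp: bloch_rel_def)
  show "refl_on ?B ?R"
    by (auto simp: refl_on_def bloch_rel_def inv_seminorm_0)
  show "sym ?R"
  proof (rule symI)
    fix f g
    assume "(f, g) \<in> ?R"
    then show "(g, f) \<in> ?R"
      using inv_seminorm_minus[of f g] by (simp add: bloch_rel_def B_inv_H_ball)
  qed
  show "trans ?R"
  proof (rule transI)
    fix f g h
    assume "(f, g) \<in> ?R" "(g, h) \<in> ?R"
    then show "(f, h) \<in> ?R"
      using inv_seminorm_triangle[of f g h] by (auto simp: bloch_rel_def B_inv_H_ball)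
  qed
qed

lemma inv_seminorm_cong:
  assumes "(f, g) \<in> bloch_rel"
  shows "inv_seminorm f = inv_seminorm g"
proof -
  have "f \<in> H_ball" "g \<in> H_ball" "inv_seminorm (\<lambda>x. f x - g x) = 0"
    "inv_seminorm (\<lambda>x. g x - f x) = 0"
    using assms inv_seminorm_minus[of f g] by (auto simp: bloch_rel_def B_inv_H_ball)
  then show ?thesis
    using inv_seminorm_triangle[of f g "\<lambda>x. 0"] inv_seminorm_triangle[of g f "\<lambda>x. 0"] H_ball_0
    by (intro antisym) auto
qed

lemma bloch_rel_diff:
  assumes "(f, f') \<in> bloch_rel" "(g, g') \<in> bloch_rel"
  shows "((\<lambda>x. f x - g x), (\<lambda>x. f' x - g' x)) \<in> bloch_rel"
proof -
  have *: "f \<in> B_inv" "f' \<in> B_inv" "g \<in> B_inv" "g' \<in> B_inv"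
    using assms by (auto simp: bloch_rel_def)
  have "inv_seminorm (\<lambda>x. (f x - f' x) - (g x - g' x))
      \<le> inv_seminorm (\<lambda>x. f x - f' x) + inv_seminorm (\<lambda>x. g x - g' x)"
    by (intro inv_seminorm_diff_le H_ball_diff B_inv_H_ball *)
  moreover have "(\<lambda>x. (f x - f' x) - (g x - g' x)) = (\<lambda>x. (f x - g x) - (f' x - g' x))"
    by auto
  ultimately show ?thesis
    using assms * by (auto simp: bloch_rel_def B_inv_diff)
qed

lemma bloch_class_self: "f \<in> B_inv \<Longrightarrow> f \<in> bloch_class f"
  unfolding bloch_class_def by (rule equiv_class_self[OF equiv_bloch_rel])

theorem bloch_diff_class:
  assumes "f \<in> B_inv" "g \<in> B_inv"
  shows "bloch_diff (bloch_class f) (bloch_class g) = bloch_class (\<lambda>x. f x - g x)"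
proof -
  have *: "bloch_class (\<lambda>x. f' x - g' x) = bloch_class (\<lambda>x. f x - g x)"
    if "f' \<in> bloch_class f" "g' \<in> bloch_class g" for f' g'
  proof -
    have "((\<lambda>x. f x - g x), (\<lambda>x. f' x - g' x)) \<in> bloch_rel"
      using that by (intro bloch_rel_diff) (simp_all add: bloch_class_def)
    then show ?thesis
      unfolding bloch_class_def by (rule equiv_class_eq[OF equiv_bloch_rel, symmetric])
  qed
  have "bloch_diff (bloch_class f) (bloch_class g)
      = (\<Union>f'\<in>bloch_class f. \<Union>g'\<in>bloch_class g. bloch_class (\<lambda>x. f x - g x))"
    unfolding bloch_diff_def by (intro SUP_cong refl *)
  also have "\<dots> = bloch_class (\<lambda>x. f x - g x)"
    using bloch_class_self[OF assms(1)] bloch_class_self[OF assms(2)] by blast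
  finally show ?thesis .
qed

theorem bloch_norm_class:
  assumes "f \<in> B_inv"
  shows "bloch_norm (bloch_class f) = enn2real (inv_seminorm f)"
proof -
  have "enn2real (inv_seminorm g) = enn2real (inv_seminorm f)" if "g \<in> bloch_class f" for g
    using inv_seminorm_cong[of f g] that by (simp add: bloch_class_def)
  then have "(\<lambda>g. enn2real (inv_seminorm g)) ` bloch_class f
      = (\<lambda>g. enn2real (inv_seminorm f)) ` bloch_class f"
    by (rule image_cong[OF refl])
  also have "\<dots> = {enn2real (inv_seminorm f)}"
    using bloch_class_self[OF assms] by blast
  finally show ?thesis
    by (simp add: bloch_norm_def)
qed

lemma bloch_class_in_space: "f \<in> B_inv \<Longrightarrow> bloch_class f \<in> bloch_space"
  by (simp add: bloch_space_def bloch_class_def quotientI)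

lemma bloch_dist_class:
  "f \<in> B_inv \<Longrightarrow> g \<in> B_inv \<Longrightarrow>
    bloch_dist (bloch_class f) (bloch_class g) = enn2real (inv_seminorm (\<lambda>x. f x - g x))"
  by (simp add: bloch_dist_def bloch_diff_class bloch_norm_class B_inv_diff bloch_class_in_space)

lemma bloch_spaceE:
  assumes "X \<in> bloch_space"
  obtains f where "f \<in> B_inv" "X = bloch_class f"
  using assms by (auto simp: bloch_space_def bloch_class_def elim: quotientE)

theorem Metric_space_bloch: "Metric_space bloch_space bloch_dist"
proof
  fix X Y :: "('a \<Rightarrow> complex) set"
  show "0 \<le> bloch_dist X Y"
  proof (cases "X \<in> bloch_space \<and> Y \<in> bloch_space")
    case True
    then show ?thesis
      by (auto elim!: bloch_spaceE simp: bloch_dist_class)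
  qed (auto simp: bloch_dist_def)
  show "bloch_dist X Y = bloch_dist Y X"
  proof (cases "X \<in> bloch_space \<and> Y \<in> bloch_space")
    case True
    then obtain f g where "f \<in> B_inv" "X = bloch_class f" "g \<in> B_inv" "Y = bloch_class g"
      by (meson bloch_spaceE)
    then show ?thesis
      using inv_seminorm_minus[of f g] by (simp add: bloch_dist_class B_inv_H_ball)
  qed (auto simp: bloch_dist_def)
next
  fix X Y :: "('a \<Rightarrow> complex) set"
  assume "X \<in> bloch_space" "Y \<in> bloch_space"
  then obtain f g where f: "f \<in> B_inv" "X = bloch_class f" and g: "g \<in> B_inv" "Y = bloch_class g"
    by (meson bloch_spaceE)
  have "X = Y \<longleftrightarrow> (f, g) \<in> bloch_rel"
    using f g eq_equiv_class_iff[OF equiv_bloch_rel] by (simp add: bloch_class_def)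
  moreover have "inv_seminorm (\<lambda>x. f x - g x) < \<infinity>"
    using B_inv_diff[OF f(1) g(1)] by (simp add: B_inv_def)
  ultimately show "bloch_dist X Y = 0 \<longleftrightarrow> X = Y"
    using f g by (auto simp: bloch_dist_class bloch_rel_def enn2real_eq_0_iff)
next
  fix X Y Z :: "('a \<Rightarrow> complex) set"
  assume "X \<in> bloch_space" "Y \<in> bloch_space" "Z \<in> bloch_space"
  then obtain f g h where f: "f \<in> B_inv" "X = bloch_class f" and g: "g \<in> B_inv" "Y = bloch_class g"
    and h: "h \<in> B_inv" "Z = bloch_class h"
    by (meson bloch_spaceE)
  have fin: "inv_seminorm (\<lambda>x. f x - g x) < \<infinity>" "inv_seminorm (\<lambda>x. g x - h x) < \<infinity>"
    using B_inv_diff f(1) g(1) h(1) by (auto simp: B_inv_def)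
  then have "enn2real (inv_seminorm (\<lambda>x. f x - h x))
      \<le> enn2real (inv_seminorm (\<lambda>x. f x - g x) + inv_seminorm (\<lambda>x. g x - h x))"
    using inv_seminorm_triangle[of f g h] f(1) g(1) h(1)
    by (intro enn2real_mono) (auto simp: B_inv_H_ball)
  also have "\<dots> = enn2real (inv_seminorm (\<lambda>x. f x - g x)) + enn2real (inv_seminorm (\<lambda>x. g x - h x))"
    using fin by (intro enn2real_plus) auto
  finally show "bloch_dist X Z \<le> bloch_dist X Y + bloch_dist Y Z"
    using f g h by (simp add: bloch_dist_class)
qed

lemma H_infty_diff:
  assumes "f \<in> H_infty" "g \<in> H_infty"
  shows "(\<lambda>x. f x - g x) \<in> H_infty"
  using assms bounded_minus_comp[of f "ball 0 1" g] by (auto simp: H_infty_def H_ball_diff)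

lemma sup_norm_upper:
  assumes "f \<in> H_infty"
  shows "cmod (f x) \<le> sup_norm f"
proof -
  have bdd: "bdd_above ((\<lambda>x. cmod (f x)) ` ball 0 1)"
    using assms by (auto simp: H_infty_def bounded_iff bdd_above_def)
  have upper: "cmod (f x) \<le> sup_norm f" if "x \<in> ball 0 1" for x
    unfolding sup_norm_def using that bdd by (rule cSUP_upper)
  have "0 \<le> sup_norm f"
    using upper[of 0] norm_ge_zero[of "f 0"] by (simp del: norm_ge_zero)
  then show ?thesis
    using upper assms by (cases "x \<in> ball 0 1") (auto simp: H_infty_def H_ball_def)
qed

lemma sup_norm_least: "(\<And>x. cmod (f x) \<le> b) \<Longrightarrow> sup_norm f \<le> b"
  unfolding sup_norm_def by (rule cSUP_least) auto

theorem Metric_space_H_infty: "Metric_space H_infty sup_dist"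
proof
  fix f g :: "'a \<Rightarrow> complex"
  show "0 \<le> sup_dist f g"
    using order_trans[OF norm_ge_zero sup_norm_upper[OF H_infty_diff]]
    by (auto simp: sup_dist_def)
  show "sup_dist f g = sup_dist g f"
    by (simp add: sup_dist_def sup_norm_def norm_minus_commute)
next
  fix f g :: "'a \<Rightarrow> complex"
  assume fg: "f \<in> H_infty" "g \<in> H_infty"
  have "f = g" if "sup_norm (\<lambda>x. f x - g x) = 0"
    using sup_norm_upper[OF H_infty_diff[OF fg]] that by (intro ext) simp
  moreover have "sup_norm (\<lambda>x. f x - g x) = 0" if "f = g"
    using that by (simp add: sup_norm_def)
  ultimately show "sup_dist f g = 0 \<longleftrightarrow> f = g"
    using fg by (auto simp: sup_dist_def)
next
  fix f g h :: "'a \<Rightarrow> complex"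
  assume f: "f \<in> H_infty" and g: "g \<in> H_infty" and h: "h \<in> H_infty"
  have "sup_norm (\<lambda>x. f x - h x) \<le> sup_norm (\<lambda>x. f x - g x) + sup_norm (\<lambda>x. g x - h x)"
  proof (rule sup_norm_least)
    fix x
    have "cmod (f x - h x) \<le> cmod (f x - g x) + cmod (g x - h x)"
      using norm_triangle_ineq[of "f x - g x" "g x - h x"] by simp
    also have "\<dots> \<le> sup_norm (\<lambda>x. f x - g x) + sup_norm (\<lambda>x. g x - h x)"
      by (intro add_mono sup_norm_upper[OF H_infty_diff[OF f g]] sup_norm_upper[OF H_infty_diff[OF g h]])
    finally show "cmod (f x - h x) \<le> \<dots>" .
  qed
  then show "sup_dist f h \<le> sup_dist f g + sup_dist g h"
    using f g h by (simp add: sup_dist_def)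
qed

end

theory Submission
  imports Defs "HOL-Complex_Analysis.Cauchy_Integral_Formula"
begin

text \<open>Composing with an automorphism of the ball does not enlarge the supremum of the modulus,
  so \<open>f \<circ> p\<close> is again holomorphic and bounded by \<open>sup_norm f\<close>.
  Restricted to the complex line through \<open>v\<close>, it is a function of one variable on the
  disc of radius \<open>1 / norm v\<close>, and Cauchy's estimate at the centre bounds its
  derivative in direction \<open>v\<close> by \<open>sup_norm f * norm v\<close>
  (\<open>cfrechet_derivative_bound\<close>). This bound does not depend on \<open>p\<close>, which
  gives \<open>inv_seminorm f \<le> sup_norm f\<close> (\<open>inv_seminorm_le_sup_norm\<close>).
  Applied to differences, the same inequality makes the canonical map 1-Lipschitz
  (\<open>bloch_dist_le_sup_dist\<close>), hence continuous.\<close>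

lemma bounded_linear_scaleC_left: "bounded_linear (\<lambda>z. z *\<^sub>C (v::'a::complex_normed_vector))"
  by (rule bounded_linear_intro[where K = "norm v"])
    (simp_all add: scaleC_add_left scaleR_scaleC[of _ "_ *\<^sub>C v"] scaleC_scaleC norm_scaleC
      scaleR_conv_of_real)

text \<open>Cauchy's estimate on the complex line through \<open>v\<close>.\<close>

lemma cfrechet_derivative_bound:
  fixes g :: "'a::complex_normed_vector \<Rightarrow> complex"
  assumes hol: "cfrechet_holomorphic_on g (ball 0 1)"
    and bound: "\<And>x. x \<in> ball 0 1 \<Longrightarrow> cmod (g x) \<le> M"
    and D: "(g has_derivative D) (at 0)"
  shows "cmod (D v) \<le> M * norm v"
proof (cases "v = 0")
  case True
  then show ?thesis
    using linear_0[OF has_derivative_linear[OF D]] by simp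
next
  case False
  show ?thesis
  \<comment> \<open>Cauchy's estimate is taken on a closed disc, which must stay inside the open
    ball. Hence the radius is \<open>t / norm v\<close> with \<open>t < 1\<close>; letting
    \<open>t\<close> tend to 1 recovers the sharp constant.\<close>
  proof (rule field_le_mult_one_interval)
    fix t :: real
    assume t: "0 < t" "t < 1"
    define r where "r = t / norm v"
    define h where "h = (\<lambda>z. g (z *\<^sub>C v))"
    have r: "r > 0" "r * norm v = t"
      using t False by (simp_all add: r_def)
    have in_ball: "z *\<^sub>C v \<in> ball 0 1" if "cmod z \<le> r" for z
    proof -
      have "cmod z * norm v \<le> r * norm v"
        using that by (intro mult_right_mono) auto
      then show ?thesis
        using t r by (simp add: norm_scaleC)
    qed
    have line: "((\<lambda>z. z *\<^sub>C v) has_derivative (\<lambda>z. z *\<^sub>C v)) (at z)" for z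
      by (rule bounded_linear_imp_has_derivative[OF bounded_linear_scaleC_left])
    have deriv_h: "\<exists>E. (g has_derivative E) (at (z *\<^sub>C v)) \<and> (h has_field_derivative E v) (at z)"
      if z: "cmod z \<le> r" for z
    proof -
      obtain E where E: "(g has_derivative E) (at (z *\<^sub>C v))" "\<And>c v. E (c *\<^sub>C v) = c *\<^sub>C E v"
        using hol in_ball[OF z] unfolding cfrechet_holomorphic_on_def by blast
      have "(h has_derivative (\<lambda>c. E (c *\<^sub>C v))) (at z)"
        using diff_chain_at[OF line E(1)] by (simp add: h_def o_def)
      \<comment> \<open>Complex linearity of \<open>E\<close> enters here: it turns the real
        derivative of \<open>h\<close> into multiplication by a complex number, so \<open>h\<close>
        is holomorphic in the classical sense.\<close>
      moreover have "(\<lambda>c. E (c *\<^sub>C v)) = (*) (E v)"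
        by (simp add: fun_eq_iff E(2) scaleC_complex_def mult.commute)
      ultimately have "(h has_field_derivative E v) (at z)"
        by (simp only: has_field_derivative_def)
      with E(1) show ?thesis
        by blast
    qed
    have h_differentiable: "h field_differentiable at z" if "cmod z \<le> r" for z
      using deriv_h[OF that] by (auto simp: field_differentiable_def)
    have "h holomorphic_on ball 0 r"
      unfolding holomorphic_on_def
      by (auto intro!: field_differentiable_at_within h_differentiable)
    moreover have "continuous_on (cball 0 r) h"
      by (auto intro!: continuous_at_imp_continuous_on field_differentiable_imp_continuous_at
          h_differentiable)
    moreover have "cmod (h z) \<le> M" if "cmod (0 - z) = r" for z
      using that bound in_ball by (simp add: h_def)
    ultimately have "cmod ((deriv ^^ 1) h 0) \<le> fact 1 * M / r ^ 1"
      using r(1) by (intro Cauchy_inequality)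
    \<comment> \<open>The derivative of \<open>g\<close> at 0 is unique, so the \<open>E\<close>
      supplied by \<open>deriv_h\<close> at \<open>z = 0\<close> is \<open>D\<close>.\<close>
    moreover have "deriv h 0 = D v"
    proof -
      have zero: "(0::complex) *\<^sub>C v = 0"
        using linear_0[OF bounded_linear.linear[OF bounded_linear_scaleC_left]] .
      obtain E where "(g has_derivative E) (at 0)" "(h has_field_derivative E v) (at 0)"
        using deriv_h[of 0] r(1) by (auto simp: zero)
      then show ?thesis
        by (metis has_derivative_unique[OF D] DERIV_imp_deriv)
    qed
    ultimately have "r * cmod (D v) \<le> M"
      using r(1) by (simp add: field_simps)
    then have "r * cmod (D v) * norm v \<le> M * norm v"
      by (intro mult_right_mono) auto
    then show "t * cmod (D v) \<le> M * norm v"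
      by (simp add: r(2)[symmetric] mult_ac)
  qed
qed

text \<open>The chain rule applies at every point because \<open>p\<close> maps the ball into
  itself, and a composite of complex-linear maps is complex-linear. Cauchy's estimate needs this on
  the whole ball, whereas \<open>H_ball_comp_differentiable\<close> gives only real
  differentiability at 0.\<close>

lemma H_ball_comp_has_derivative:
  assumes f: "f \<in> H_ball" and p: "p \<in> Aut_ball" and x: "x \<in> ball 0 1"
  shows "\<exists>D. ((f \<circ> p) has_derivative D) (at x) \<and> (\<forall>c v. D (c *\<^sub>C v) = c *\<^sub>C D v)"
proof -
  have px: "p x \<in> ball 0 1"
    using p x by (auto simp: Aut_ball_def dest!: bij_betwE)
  obtain D where D: "(p has_derivative D) (at x)" "\<forall>c v. D (c *\<^sub>C v) = c *\<^sub>C D v"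
    using p x unfolding Aut_ball_def cfrechet_holomorphic_on_def by blast
  obtain E where E: "(f has_derivative E) (at (p x))" "\<forall>c v. E (c *\<^sub>C v) = c *\<^sub>C E v"
    using f px unfolding H_ball_def cfrechet_holomorphic_on_def by blast
  have "((f \<circ> p) has_derivative E \<circ> D) (at x)"
    by (rule diff_chain_at[OF D(1) E(1)])
  with D(2) E(2) show ?thesis
    by (intro exI[of _ "E \<circ> D"]) simp
qed

lemma inv_seminorm_le_sup_norm:
  assumes f: "f \<in> H_infty"
  shows "inv_seminorm f \<le> ennreal (sup_norm f)"
  unfolding inv_seminorm_def
proof (intro SUP_least ennreal_leI)
  fix p :: "'a \<Rightarrow> 'a"
  assume p: "p \<in> Aut_ball"
  have fH: "f \<in> H_ball"
    using f by (simp add: H_infty_def)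
  have hol: "cfrechet_holomorphic_on (f \<circ> p) (ball 0 1)"
    unfolding cfrechet_holomorphic_on_def using H_ball_comp_has_derivative[OF fH p] by blast
  have der: "((f \<circ> p) has_derivative frechet_derivative (f \<circ> p) (at 0)) (at 0)"
    using H_ball_comp_differentiable[OF fH p] by (simp add: frechet_derivative_works)
  \<comment> \<open>\<open>f\<close> vanishes off the ball, so \<open>sup_norm_upper\<close> holds
    at every point, in particular at \<open>p x\<close>.\<close>
  have bound: "cmod ((f \<circ> p) x) \<le> sup_norm f" for x
    using sup_norm_upper[OF f] by simp
  show "onorm (frechet_derivative (f \<circ> p) (at 0)) \<le> sup_norm f"
  proof (rule onorm_bound)
    show "0 \<le> sup_norm f"
      by (rule order_trans[OF norm_ge_zero bound])
    show "cmod (frechet_derivative (f \<circ> p) (at 0) v) \<le> sup_norm f * norm v" for v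
      by (rule cfrechet_derivative_bound[OF hol bound der])
  qed
qed

lemma H_infty_subset_B_inv: "H_infty \<subseteq> B_inv"
proof
  fix f :: "'a \<Rightarrow> complex"
  assume "f \<in> H_infty"
  then show "f \<in> B_inv"
    using le_less_trans[OF inv_seminorm_le_sup_norm ennreal_less_top]
    by (simp add: B_inv_def H_infty_def)
qed

text \<open>The distance of two classes is the seminorm of the difference of their representatives,
  and that difference again lies in \<open>H_infty\<close>.\<close>

lemma bloch_dist_le_sup_dist:
  assumes "f \<in> H_infty" "g \<in> H_infty"
  shows "bloch_dist (bloch_class f) (bloch_class g) \<le> sup_dist f g"
proof -
  have fg: "(\<lambda>x. f x - g x) \<in> H_infty"
    by (rule H_infty_diff[OF assms])
  have "enn2real (inv_seminorm (\<lambda>x. f x - g x)) \<le> sup_norm (\<lambda>x. f x - g x)"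
    using inv_seminorm_le_sup_norm[OF fg] order_trans[OF norm_ge_zero sup_norm_upper[OF fg]]
    by (intro enn2real_leI)
  moreover have "f \<in> B_inv" "g \<in> B_inv"
    using assms H_infty_subset_B_inv by blast+
  ultimately show ?thesis
    using assms by (simp add: bloch_dist_class sup_dist_def)
qed

theorem proposition3p5:
  shows "(H_infty :: ('a::complex_banach \<Rightarrow> complex) set) \<subseteq> B_inv \<and>
    continuous_map
      (Metric_space.mtopology (H_infty :: ('a \<Rightarrow> complex) set) sup_dist)
      (Metric_space.mtopology bloch_space bloch_dist)
      bloch_class"
proof
  show sub: "(H_infty :: ('a \<Rightarrow> complex) set) \<subseteq> B_inv"
    by (rule H_infty_subset_B_inv)
  interpret Metric_space12 "H_infty :: ('a \<Rightarrow> complex) set" sup_dist bloch_space bloch_dist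
    by (intro Metric_space12.intro Metric_space_H_infty Metric_space_bloch)
  show "continuous_map M1.mtopology M2.mtopology (bloch_class :: ('a \<Rightarrow> complex) \<Rightarrow> _)"
    unfolding M1.metric_continuous_map[OF M2.Metric_space_axioms]
  proof (intro conjI ballI allI impI)
    show "bloch_class ` (H_infty :: ('a \<Rightarrow> complex) set) \<subseteq> bloch_space"
      using sub bloch_class_in_space by blast
  next
    fix f :: "'a \<Rightarrow> complex" and e :: real
    assume "f \<in> H_infty" "0 < e"
    show "\<exists>d>0. \<forall>g. g \<in> H_infty \<and> sup_dist f g < d \<longrightarrow>
        bloch_dist (bloch_class f) (bloch_class g) < e"
    \<comment> \<open>The Lipschitz constant is 1, so \<open>e\<close> itself serves as the
      radius.\<close>
    proof (intro exI[of _ e] conjI allI impI)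
      show "bloch_dist (bloch_class f) (bloch_class g) < e"
        if "g \<in> H_infty \<and> sup_dist f g < e" for g
        using le_less_trans[OF bloch_dist_le_sup_dist[OF \<open>f \<in> H_infty\<close>]] that by simp
    qed (fact \<open>0 < e\<close>)
  qed
qed

end
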